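(* Let $p$ be a prime and let $\mathfrak{h}(1)=\langle x,y,z \mid [x,y]=z\rangle$ be the three dimensional Heisenberg Lie algebra over $\mathbb{F}_p$. Then its subalgebra commutativity degree is $$\mathrm{sd}(\mathfrak{h}(1))=\frac{3p^3+12p^2+16p+16}{(p^2+2p+4)^2}.$$
   Context: $\mathfrak{h}(1)$ is the Lie algebra over $\mathbb{F}_p$ with basis $x,y,z$ in which $[x,y]=z$ and $z$ is central ($[x,z]=[y,z]=0$). For a finite dimensional Lie algebra $L$ over a finite field, $\mathcal{L}(L)$ denotes the (finite) set of all Lie subalgebras of $L$, including $\{0\}$ and $L$. For $A,B\in\mathcal{L}(L)$, $A+B$ is the vector space sum and $[A,B]$ is the smallest Lie subalgebra of $L$ containing all brackets $[a,b]$ with $a\in A$, $b\in B$. The subalgebra commutativity degree of $L$ is $$\mathrm{sd}(L)=\frac{1}{|\mathcal{L}(L)|^2}\left|\{(A,B)\in\mathcal{L}(L)\times\mathcal{L}(L) \mid [A,B]\subseteq A+B\}\right|.$$ *)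

theory Defs
  imports Complex_Main "HOL-Computational_Algebra.Primes" "HOL-Library.Cardinality"
    "HOL-Library.Product_Plus"
begin

locale lie_algebra = vector_space scale
  for scale :: "'k::field \<Rightarrow> 'v::ab_group_add \<Rightarrow> 'v" +
  fixes bracket :: "'v \<Rightarrow> 'v \<Rightarrow> 'v"
  assumes bracket_add_left: "bracket (u + v) w = bracket u w + bracket v w"
    and bracket_add_right: "bracket u (v + w) = bracket u v + bracket u w"
    and bracket_scale_left: "bracket (scale c u) v = scale c (bracket u v)"
    and bracket_scale_right: "bracket u (scale c v) = scale c (bracket u v)"
    and bracket_self: "bracket u u = 0"
    and jacobi: "bracket u (bracket v w) + bracket v (bracket w u) + bracket w (bracket u v) = 0"
begin

definition lie_subalgebra :: "'v set \<Rightarrow> bool" where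
  "lie_subalgebra A \<longleftrightarrow> subspace A \<and> (\<forall>a\<in>A. \<forall>b\<in>A. bracket a b \<in> A)"

definition subalgebras :: "'v set set" where
  "subalgebras = {A. lie_subalgebra A}"

definition space_sum :: "'v set \<Rightarrow> 'v set \<Rightarrow> 'v set" where
  "space_sum A B = {a + b | a b. a \<in> A \<and> b \<in> B}"

definition commutator :: "'v set \<Rightarrow> 'v set \<Rightarrow> 'v set" where
  "commutator A B =
     \<Inter> {C. lie_subalgebra C \<and> (\<forall>a\<in>A. \<forall>b\<in>B. bracket a b \<in> C)}"

text \<open>Meaningful only if there are finitely many subalgebras, e.g. for a finite dimensional
  Lie algebra over a finite field; otherwise both cardinalities may degenerate to 0.\<close>

definition sd :: real where
  "sd = real (card {(A, B). A \<in> subalgebras \<and> B \<in> subalgebras \<and>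
                        commutator A B \<subseteq> space_sum A B}) /
        (real (card subalgebras))\<^sup>2"

end

text \<open>The Heisenberg algebra is given by its structure constants with respect to a basis, and so
  up to isomorphism; the lemma \<open>heisenberg_model\<close> below shows that it exists over every field.\<close>

locale heisenberg = lie_algebra scale bracket
  for scale :: "'k::field \<Rightarrow> 'v::ab_group_add \<Rightarrow> 'v"
    and bracket :: "'v \<Rightarrow> 'v \<Rightarrow> 'v" +
  fixes x y z :: 'v
  assumes basis_distinct: "distinct [x, y, z]"
    and basis_independent: "independent {x, y, z}"
    and basis_span: "span {x, y, z} = UNIV"
    and bracket_xy: "bracket x y = z"
    and bracket_xz: "bracket x z = 0"
    and bracket_yz: "bracket y z = 0"

lemma heisenberg_model:
  "heisenberg (\<lambda>(c::'k::field) (a, b, d). (c * a, c * b, c * d))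
     (\<lambda>(a, b, d) (a', b', d'). (0, 0, a * b' - b * a'))
     (1, 0, 0) (0, 1, 0) (0, 0, 1)"
proof -
  let ?s = "\<lambda>(c::'k) (a, b, d). (c * a, c * b, c * d)"
  let ?B = "{(1, 0, 0), (0, 1, 0), (0, 0, 1)} :: ('k \<times> 'k \<times> 'k) set"
  interpret V: vector_space ?s
    by unfold_locales (auto simp: algebra_simps)
  have span: "(a, b, d) \<in> V.span ?B" for a b d
  proof -
    have "?s a (1,0,0) + (?s b (0,1,0) + ?s d (0,0,1)) \<in> V.span ?B"
      by (intro V.span_add V.span_scale V.span_base) auto
    then show ?thesis by simp
  qed
  have indep: "V.independent ?B"
  proof
    assume "V.dependent ?B"
    then obtain f where f: "(\<Sum>v\<in>?B. ?s (f v) v) = 0" "\<exists>v\<in>?B. f v \<noteq> 0"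
      by (auto simp: V.dependent_finite)
    then show False by (auto simp: zero_prod_def)
  qed
  show ?thesis
    by unfold_locales (use span indep in \<open>auto simp: algebra_simps zero_prod_def\<close>)
qed

end

theory Submission
  imports Defs
begin

text \<open>A subalgebra that contains \<open>z\<close> corresponds to a subspace of the plane modulo \<open>z\<close>; one that
  does not contain \<open>z\<close> is zero or a line, because two of its elements with independent images
  modulo \<open>z\<close> would have a nonzero multiple of \<open>z\<close> as bracket. Since every commutator lies in the
  line of \<open>z\<close>, a pair \<open>(A, B)\<close> fails \<open>[A, B] \<subseteq> A + B\<close> exactly if \<open>A\<close> and \<open>B\<close> are lines with
  different nonzero images modulo \<open>z\<close>.\<close>

text \<open>Points of the projective line over \<open>'k\<close>, with representatives \<open>(1, m)\<close> and \<open>(0, 1)\<close>.\<close>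

fun dir1 :: "'k::field option \<Rightarrow> 'k" where
  "dir1 (Some m) = 1"
| "dir1 None = 0"

fun dir2 :: "'k::field option \<Rightarrow> 'k" where
  "dir2 (Some m) = m"
| "dir2 None = 1"

text \<open>The determinant of two representatives vanishes if they are proportional; being
  normalised, proportional representatives belong to the same point.\<close>

lemma dir_det_eq_0_iff: "dir1 s * dir2 t = dir2 s * dir1 t \<longleftrightarrow> s = t"
  by (cases s; cases t) auto

text \<open>One coordinate of each representative is 1, so the factor \<open>t\<close> can be read
  off there: it is \<open>a\<close> for \<open>Some m\<close> and \<open>b\<close> for
  \<open>None\<close>.\<close>

lemma dir_parallel:
  assumes "dir1 s * b = dir2 s * a"
  obtains t where "a = t * dir1 s" "b = t * dir2 s"
proof (cases s)
  case None
  then show ?thesis using assms that[of b] by auto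
next
  case (Some m)
  then show ?thesis using assms that[of a] by (auto simp: mult.commute)
qed

lemma dir_exists:
  fixes a b :: "'k::field"
  assumes "a \<noteq> 0 \<or> b \<noteq> 0"
  obtains s t where "t \<noteq> 0" "a = t * dir1 s" "b = t * dir2 s"
proof (cases "a = 0")
  case True
  then show ?thesis using assms that[of b None] by auto
next
  case False
  then show ?thesis using that[of a "Some (b / a)"] by auto
qed

lemma dir_nonzero: "dir1 s = 0 \<Longrightarrow> dir2 s \<noteq> 0"
  by (cases s) auto

context heisenberg
begin

section \<open>Coordinates with respect to the basis, and the bracket in coordinates\<close>

definition vec :: "'k \<Rightarrow> 'k \<Rightarrow> 'k \<Rightarrow> 'v" where
  "vec a b c = scale a x + scale b y + scale c z"

lemma vec_add: "vec a b c + vec a' b' c' = vec (a + a') (b + b') (c + c')"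
  by (simp add: vec_def scale_left_distrib algebra_simps)

lemma scale_vec: "scale t (vec a b c) = vec (t * a) (t * b) (t * c)"
  by (simp add: vec_def scale_right_distrib)

lemma vec_0: "vec 0 0 0 = 0"
  by (simp add: vec_def)

lemma vec_z: "vec 0 0 1 = z"
  by (simp add: vec_def)

text \<open>As a rewrite rule, \<open>z = vec 0 0 1\<close> would loop, since the locale constant \<open>vec\<close> has \<open>z\<close> as an
  implicit argument.\<close>

lemma z_in_iff: "z \<in> A \<longleftrightarrow> vec 0 0 1 \<in> A"
  by (simp add: vec_z)

lemma vec_eq_0_iff: "vec a b c = 0 \<longleftrightarrow> a = 0 \<and> b = 0 \<and> c = 0"
proof
  assume *: "vec a b c = 0"
  \<comment> \<open>Independence speaks of coefficient functions on the basis as a set, so the three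
    coefficients are merged into one function; \<open>d\<close> keeps its cases apart.\<close>
  let ?f = "\<lambda>v. if v = x then a else if v = y then b else c"
  have d: "x \<noteq> y" "x \<noteq> z" "y \<noteq> z" using basis_distinct by auto
  have "(\<Sum>v\<in>{x, y, z}. scale (?f v) v) = 0"
    using * d by (simp add: vec_def add.assoc)
  then have "?f v = 0" if "v \<in> {x, y, z}" for v
    using independentD[OF basis_independent _ subset_refl, of ?f v] that by simp
  from this[of x] this[of y] this[of z] show "a = 0 \<and> b = 0 \<and> c = 0" using d by auto
qed (simp add: vec_0)

lemma vec_eq_iff: "vec a b c = vec a' b' c' \<longleftrightarrow> a = a' \<and> b = b' \<and> c = c'"
proof -
  have "vec a b c = vec a' b' c' \<longleftrightarrow> vec a b c + scale (- 1) (vec a' b' c') = 0"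
    by simp
  then show ?thesis by (simp add: scale_vec vec_add vec_eq_0_iff)
qed

lemma vec_exhaust: obtains a b c where "v = vec a b c"
proof -
  have "v \<in> span {x, y, z}" using basis_span by auto
  then obtain a b c where "v - scale a x - scale b y - scale c z = 0"
    by (auto simp: span_insert)
  then have "v = vec a b c" by (simp add: vec_def algebra_simps)
  then show ?thesis by (rule that)
qed

text \<open>Polarisation: expand the vanishing bracket of \<open>u + v\<close> with itself.\<close>

lemma bracket_swap: "bracket u v = - bracket v u"
proof -
  have "bracket u v + bracket v u = bracket (u + v) (u + v)"
    unfolding bracket_add_left bracket_add_right by (simp add: bracket_self)
  then have "bracket u v + bracket v u = 0" by (simp add: bracket_self)
  then show ?thesis by (rule eq_neg_iff_add_eq_0[THEN iffD2])
qed

text \<open>Reduces every bracket to the 2x2 determinant of the images modulo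
  \<open>z\<close>.\<close>

lemma bracket_vec: "bracket (vec a b c) (vec a' b' c') = vec 0 0 (a * b' - b * a')"
proof -
  have "bracket y x = - z" "bracket z x = 0" "bracket z y = 0"
    using bracket_swap[of y x] bracket_swap[of z x] bracket_swap[of z y]
    by (simp_all add: bracket_xy bracket_xz bracket_yz)
  then show ?thesis
    by (simp add: vec_def bracket_add_left bracket_add_right bracket_scale_left
        bracket_scale_right bracket_self bracket_xy bracket_xz bracket_yz
        scale_left_diff_distrib mult.commute)
qed

section \<open>The nontrivial families of subalgebras\<close>

definition center_line :: "'v set" where
  "center_line = {vec 0 0 c | c. True}"

text \<open>The preimage of the point \<open>s\<close> of the projective line under the projection
  modulo \<open>z\<close>.\<close>

definition plane :: "'k option \<Rightarrow> 'v set" where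
  "plane s = {vec (t * dir1 s) (t * dir2 s) c | t c. True}"

text \<open>The lines other than \<open>center_line\<close>, each given by its unique generator
  whose image modulo \<open>z\<close> is a normalised representative. Taking a pair as argument lets
  them be counted as the range of an injective function.\<close>

definition line :: "'k option \<times> 'k \<Rightarrow> 'v set" where
  "line = (\<lambda>(s, c). {vec (t * dir1 s) (t * dir2 s) (t * c) | t. True})"

lemma vec_in_center_line [simp]: "vec a b c \<in> center_line \<longleftrightarrow> a = 0 \<and> b = 0"
  by (auto simp: center_line_def vec_eq_iff)

lemma vec_in_plane: "vec a b c \<in> plane s \<longleftrightarrow> dir1 s * b = dir2 s * a"
  by (auto simp: plane_def vec_eq_iff elim: dir_parallel)

lemma vec_in_line:
  "vec a b c \<in> line (s, e) \<longleftrightarrow> (\<exists>t. a = t * dir1 s \<and> b = t * dir2 s \<and> c = t * e)"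
  by (auto simp: line_def vec_eq_iff)

lemma lie_subalgebraI:
  assumes "vec 0 0 0 \<in> A"
    and "\<And>a b c a' b' c'. vec a b c \<in> A \<Longrightarrow> vec a' b' c' \<in> A \<Longrightarrow> vec (a + a') (b + b') (c + c') \<in> A"
    and "\<And>t a b c. vec a b c \<in> A \<Longrightarrow> vec (t * a) (t * b) (t * c) \<in> A"
    and "\<And>a b c a' b' c'. vec a b c \<in> A \<Longrightarrow> vec a' b' c' \<in> A \<Longrightarrow> vec 0 0 (a * b' - b * a') \<in> A"
  shows "lie_subalgebra A"
  unfolding lie_subalgebra_def subspace_def
proof (intro conjI ballI allI)
  show "0 \<in> A" using assms(1) by (simp add: vec_0)
next
  fix u v assume "u \<in> A" "v \<in> A"
  then show "u + v \<in> A"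
    by (cases u rule: vec_exhaust; cases v rule: vec_exhaust) (simp add: vec_add assms(2))
next
  fix t v assume "v \<in> A"
  then show "scale t v \<in> A" by (cases v rule: vec_exhaust) (simp add: scale_vec assms(3))
next
  fix u v assume "u \<in> A" "v \<in> A"
  then show "bracket u v \<in> A"
    by (cases u rule: vec_exhaust; cases v rule: vec_exhaust) (simp add: bracket_vec assms(4))
qed

lemma
  assumes "lie_subalgebra A"
  shows lie_subalgebra_0: "0 \<in> A"
    and lie_subalgebra_add:
      "vec a b c \<in> A \<Longrightarrow> vec a' b' c' \<in> A \<Longrightarrow> vec (a + a') (b + b') (c + c') \<in> A"
    and lie_subalgebra_scale: "vec a b c \<in> A \<Longrightarrow> vec (t * a) (t * b) (t * c) \<in> A"
    and lie_subalgebra_bracket: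
      "vec a b c \<in> A \<Longrightarrow> vec a' b' c' \<in> A \<Longrightarrow> vec 0 0 (a * b' - b * a') \<in> A"
  using assms unfolding lie_subalgebra_def subspace_def
  by (auto simp flip: vec_add scale_vec) (metis bracket_vec)

lemma lie_subalgebra_zero: "lie_subalgebra {0}"
  by (rule lie_subalgebraI) (auto simp: vec_eq_0_iff)

lemma lie_subalgebra_center_line: "lie_subalgebra center_line"
  by (rule lie_subalgebraI) auto

lemma lie_subalgebra_UNIV: "lie_subalgebra UNIV"
  by (rule lie_subalgebraI) auto

lemma lie_subalgebra_plane: "lie_subalgebra (plane s)"
  by (rule lie_subalgebraI) (auto simp: vec_in_plane algebra_simps)

lemma lie_subalgebra_line: "lie_subalgebra (line sc)"
proof (cases sc)
  case (Pair s e)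
  have "lie_subalgebra (line (s, e))"
  proof (rule lie_subalgebraI)
    fix a b c a' b' c'
    assume "vec a b c \<in> line (s, e)" "vec a' b' c' \<in> line (s, e)"
    then show "vec (a + a') (b + b') (c + c') \<in> line (s, e)"
      and "vec 0 0 (a * b' - b * a') \<in> line (s, e)"
      \<comment> \<open>Multipliers add up for the sum; the bracket of two multiples of one vector
        is zero, hence the multiplier 0.\<close>
      unfolding vec_in_line by (metis distrib_right, auto intro!: exI[of _ 0])
  next
    fix t a b c assume "vec a b c \<in> line (s, e)"
    then show "vec (t * a) (t * b) (t * c) \<in> line (s, e)"
      unfolding vec_in_line by (auto simp flip: mult.assoc)
  qed (auto simp: vec_in_line intro: exI[of _ 0])
  then show ?thesis using Pair by simp
qed

section \<open>Classification of the subalgebras\<close>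

lemma z_in_lie_subalgebra:
  assumes "lie_subalgebra A" "vec 0 0 c \<in> A" "c \<noteq> 0"
  shows "z \<in> A"
  using lie_subalgebra_scale[OF assms(1,2), of "1 / c"] assms(3) by (simp add: z_in_iff)

lemma lie_subalgebra_with_z:
  assumes A: "lie_subalgebra A" and z: "z \<in> A"
  shows "A = center_line \<or> A = UNIV \<or> A \<in> range plane"
proof -
  \<comment> \<open>Adding a multiple of \<open>z\<close> changes the last coordinate at will, so
    membership in \<open>A\<close> depends only on the image modulo \<open>z\<close>.\<close>
  have shift: "vec a b c' \<in> A" if "vec a b c \<in> A" for a b c c'
    using lie_subalgebra_add[OF A that lie_subalgebra_scale[OF A z[unfolded z_in_iff], of "c' - c"]]
    by simp
  have cent: "center_line \<subseteq> A"
    using shift[OF z[unfolded z_in_iff]] by (auto simp: center_line_def)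
  show ?thesis
  proof (cases "A \<subseteq> center_line")
    case True
    then show ?thesis using cent by auto
  next
    case False
    then obtain v where "v \<in> A" "v \<notin> center_line" by blast
    then obtain a b c where v: "vec a b c \<in> A" "a \<noteq> 0 \<or> b \<noteq> 0"
      by (cases v rule: vec_exhaust) auto
    from v(2) obtain s t where st: "t \<noteq> 0" "a = t * dir1 s" "b = t * dir2 s"
      by (rule dir_exists)
    have ds: "vec (dir1 s) (dir2 s) 0 \<in> A"
      using shift[OF lie_subalgebra_scale[OF A v(1), of "1 / t"]] st by simp
    have sub: "plane s \<subseteq> A"
      using shift[OF lie_subalgebra_scale[OF A ds]] by (auto simp: plane_def)
    show ?thesis
    proof (cases "A \<subseteq> plane s")
      case True
      then show ?thesis using sub by auto
    next
      case False
      then obtain w where "w \<in> A" "w \<notin> plane s" by blast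
      then obtain a' b' c' where w: "vec a' b' c' \<in> A" "dir1 s * b' \<noteq> dir2 s * a'"
        by (cases w rule: vec_exhaust) (auto simp: vec_in_plane)
      define D where "D = dir1 s * b' - dir2 s * a'"
      have D: "D \<noteq> 0" using w by (simp add: D_def)
      have "vec e f g \<in> A" for e f g
      proof -
        \<comment> \<open>Cramer's rule: \<open>?t\<close> and \<open>?u\<close> are the coordinates
          of \<open>(e, f)\<close> in the basis \<open>(dir1 s, dir2 s)\<close>,
          \<open>(a', b')\<close> of the plane, whose determinant is \<open>D\<close>.\<close>
        let ?t = "(e * b' - f * a') / D" and ?u = "(dir1 s * f - dir2 s * e) / D"
        have "(e * b' - f * a') * dir1 s + (dir1 s * f - dir2 s * e) * a' = e * D"
          "(e * b' - f * a') * dir2 s + (dir1 s * f - dir2 s * e) * b' = f * D"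
          by (simp_all add: D_def algebra_simps)
        then have "?t * dir1 s + ?u * a' = e" "?t * dir2 s + ?u * b' = f"
          using D by (simp_all flip: add_divide_distrib)
        then show ?thesis
          using shift[OF lie_subalgebra_add[OF A lie_subalgebra_scale[OF A ds, of ?t]
                lie_subalgebra_scale[OF A w(1), of ?u]]] by simp
      qed
      then have "v \<in> A" for v by (cases v rule: vec_exhaust) simp
      then have "A = UNIV" by blast
      then show ?thesis by simp
    qed
  qed
qed

lemma lie_subalgebra_without_z:
  assumes A: "lie_subalgebra A" and z: "z \<notin> A"
  shows "A = {0} \<or> A \<in> range line"
proof (cases "A \<subseteq> {0}")
  case True
  then show ?thesis using lie_subalgebra_0[OF A] by auto
next
  case False
  then obtain v where "v \<in> A" "v \<noteq> 0" by blast
  then obtain a b c where v: "vec a b c \<in> A" "vec a b c \<noteq> 0"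
    by (cases v rule: vec_exhaust) auto
  then have "a \<noteq> 0 \<or> b \<noteq> 0"
    using z_in_lie_subalgebra[OF A, of c] z by (auto simp: vec_eq_0_iff)
  then obtain s t where st: "t \<noteq> 0" "a = t * dir1 s" "b = t * dir2 s"
    by (rule dir_exists)
  \<comment> \<open>The last coordinate of the generator after dividing by \<open>t\<close> to
    normalise its image.\<close>
  define e where "e = c / t"
  have ds: "vec (dir1 s) (dir2 s) e \<in> A"
    using lie_subalgebra_scale[OF A v(1), of "1 / t"] st by (simp add: e_def)
  have "line (s, e) \<subseteq> A"
    using lie_subalgebra_scale[OF A ds] by (auto simp: line_def)
  moreover have "w \<in> line (s, e)" if "w \<in> A" for w
  proof -
    obtain a' b' c' where w: "w = vec a' b' c'" by (rule vec_exhaust)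
    then have wA: "vec a' b' c' \<in> A" using that by simp
    \<comment> \<open>This determinant is the \<open>z\<close>-coordinate of the bracket of the
      generator with \<open>w\<close>; if it were nonzero, \<open>z\<close> would lie in
      \<open>A\<close>.\<close>
    have "dir1 s * b' - dir2 s * a' = 0"
      using lie_subalgebra_bracket[OF A ds wA] z_in_lie_subalgebra[OF A] z by blast
    then obtain u where u: "a' = u * dir1 s" "b' = u * dir2 s"
      using dir_parallel[of s b' a'] by auto
    \<comment> \<open>Subtracting \<open>u\<close> times the generator leaves a multiple of
      \<open>z\<close>, which must be zero.\<close>
    have "vec 0 0 (c' - u * e) \<in> A"
      using lie_subalgebra_add[OF A wA lie_subalgebra_scale[OF A ds, of "- u"]] u by simp
    then have "c' = u * e"
      using z_in_lie_subalgebra[OF A, of "c' - u * e"] z by auto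
    then show ?thesis using u w by (auto simp: vec_in_line)
  qed
  ultimately have "A = line (s, e)" by auto
  then show ?thesis by auto
qed

lemma subalgebras_eq:
  "subalgebras = {{0}, center_line, UNIV} \<union> range plane \<union> range line"
proof -
  have "A \<in> {{0}, center_line, UNIV} \<union> range plane \<union> range line" if "lie_subalgebra A" for A
    using lie_subalgebra_with_z[OF that] lie_subalgebra_without_z[OF that] by auto
  then show ?thesis
    by (auto simp: subalgebras_def lie_subalgebra_zero lie_subalgebra_center_line
        lie_subalgebra_UNIV lie_subalgebra_plane lie_subalgebra_line)
qed

section \<open>Counting the subalgebras\<close>

lemma z_in_center_line: "z \<in> center_line"
  by (simp add: z_in_iff)

lemma z_in_plane: "z \<in> plane s"
  by (simp add: z_in_iff vec_in_plane)

lemma z_notin_line: "z \<notin> line sc"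
  by (cases sc) (use dir_nonzero in \<open>auto simp: z_in_iff vec_in_line\<close>)

lemma vec_in_own_line: "vec (dir1 s) (dir2 s) c \<in> line (s, c)"
  by (auto simp: vec_in_line intro: exI[of _ 1])

lemma inj_plane: "inj plane"
proof (rule injI)
  fix s t assume "plane s = plane t"
  then have "vec (dir1 s) (dir2 s) 0 \<in> plane t"
    by (metis mult.commute vec_in_plane)
  then show "s = t" by (metis dir_det_eq_0_iff vec_in_plane)
qed

lemma inj_line: "inj line"
proof (rule injI)
  fix sc te assume eq: "line sc = line te"
  obtain s c t e where st: "sc = (s, c)" "te = (t, e)" by (cases sc; cases te)
  have "vec (dir1 s) (dir2 s) c \<in> line (t, e)"
    using eq st vec_in_own_line by auto
  then obtain u where u: "dir1 s = u * dir1 t" "dir2 s = u * dir2 t" "c = u * e"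
    by (auto simp: vec_in_line)
  then have "dir1 s * dir2 t = dir2 s * dir1 t" by simp
  then have "s = t" by (simp add: dir_det_eq_0_iff)
  \<comment> \<open>Now \<open>u\<close> fixes the nonzero vector
    \<open>(dir1 t, dir2 t)\<close>.\<close>
  with u have "u = 1" using dir_nonzero[of t] by auto
  then show "sc = te" using u \<open>s = t\<close> st by simp
qed

text \<open>With \<open>q\<close> elements in the field there are \<open>q + 1\<close> points, hence
  \<open>q + 1\<close> planes and \<open>(q + 1) * q\<close> lines; the remaining 3 are zero,
  \<open>center_line\<close> and the whole algebra.\<close>

lemma card_subalgebras:
  assumes "finite (UNIV :: 'k set)"
  shows "card subalgebras = CARD('k)\<^sup>2 + 2 * CARD('k) + 4"
proof -
  have fin: "finite (UNIV :: 'k option set)" using assms by simp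
  have fin2: "finite (UNIV :: ('k option \<times> 'k) set)" using assms by (simp add: finite_prod)
  have dz: "vec (dir1 s) (dir2 s) c \<noteq> 0" for s c
    using dir_nonzero[of s] by (auto simp: vec_eq_0_iff)
  have z0: "z \<noteq> 0" using vec_eq_0_iff[of 0 0 1] by (simp add: vec_z)
  have "vec 1 0 0 \<notin> center_line" by simp
  then have "center_line \<noteq> UNIV" by blast
  moreover have "{0} \<noteq> center_line" "{0} \<noteq> (UNIV :: 'v set)"
    using z0 z_in_center_line by blast+
  ultimately have 1: "card {{0}, center_line, UNIV} = 3" by simp
  have pl: "plane s \<noteq> center_line" "plane s \<noteq> UNIV" "plane s \<noteq> {0}" for s
  proof -
    have "vec (dir1 s) (dir2 s) 0 \<in> plane s" by (simp add: vec_in_plane)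
    then show "plane s \<noteq> center_line"
      using dir_nonzero[of s] by (metis vec_in_center_line)
    show "plane s \<noteq> {0}" using z_in_plane[of s] z0 by auto
    \<comment> \<open>The representative of any second point gives a vector outside
      \<open>plane s\<close>.\<close>
    obtain t where "t \<noteq> s" by (metis option.distinct(1))
    then have "vec (dir1 t) (dir2 t) 0 \<notin> plane s"
      by (simp add: vec_in_plane dir_det_eq_0_iff)
    then show "plane s \<noteq> UNIV" by blast
  qed
  have ln: "line sc \<noteq> {0}" for sc
    by (cases sc) (metis dz singletonD vec_in_own_line)
  have "card ({{0}, center_line, UNIV} \<union> range plane) = 3 + card (range plane)"
    unfolding 1[symmetric] by (rule card_Un_disjoint) (use fin pl in auto)
  also have "card (range plane) = CARD('k) + 1"
    using assms by (simp add: card_image inj_plane card_UNIV_option)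
  finally have 2: "card ({{0}, center_line, UNIV} \<union> range plane) = CARD('k) + 4" by simp
  have "card subalgebras = CARD('k) + 4 + card (range line)"
    unfolding subalgebras_eq 2[symmetric]
  proof (rule card_Un_disjoint)
    show "({{0}, center_line, UNIV} \<union> range plane) \<inter> range line = {}"
      using ln z_notin_line z_in_center_line z_in_plane by blast
  qed (use fin fin2 in auto)
  also have "card (range line) = (CARD('k) + 1) * CARD('k)"
    using assms by (simp add: card_image inj_line card_UNIV_option card_prod)
  finally show ?thesis by (simp add: power2_eq_square)
qed

section \<open>Commutators compared with sums\<close>

text \<open>\<open>center_line\<close> is itself a subalgebra containing all brackets, so it takes
  part in the intersection.\<close>

lemma commutator_subset_center_line: "commutator A B \<subseteq> center_line"
proof -
  have "bracket u v \<in> center_line" for u v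
    by (cases u rule: vec_exhaust; cases v rule: vec_exhaust) (simp add: bracket_vec)
  then show ?thesis
    unfolding commutator_def using lie_subalgebra_center_line by blast
qed

lemma bracket_in_commutator: "a \<in> A \<Longrightarrow> b \<in> B \<Longrightarrow> bracket a b \<in> commutator A B"
  by (auto simp: commutator_def)

lemma commutator_trivial:
  assumes "\<And>a b. a \<in> A \<Longrightarrow> b \<in> B \<Longrightarrow> bracket a b = 0"
  shows "commutator A B \<subseteq> {0}"
  unfolding commutator_def using assms lie_subalgebra_zero by blast

lemma space_sum_left: "0 \<in> B \<Longrightarrow> A \<subseteq> space_sum A B"
  unfolding space_sum_def by clarsimp (metis add.right_neutral)

lemma space_sum_right: "0 \<in> A \<Longrightarrow> B \<subseteq> space_sum A B"
  unfolding space_sum_def by clarsimp (metis add.left_neutral)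

lemma center_line_subset:
  assumes "lie_subalgebra A" "z \<in> A"
  shows "center_line \<subseteq> A"
  using lie_subalgebra_scale[OF assms(1) assms(2)[unfolded z_in_iff]]
  by (auto simp: center_line_def)

text \<open>For different points the bracket of the generators is a nonzero multiple of
  \<open>z\<close>, while the sum of the lines meets \<open>center_line\<close> only in zero. For
  equal points all brackets vanish.\<close>

lemma commutator_line_line:
  "commutator (line (s, c)) (line (t, e)) \<subseteq> space_sum (line (s, c)) (line (t, e)) \<longleftrightarrow> s = t"
    (is "?C \<subseteq> ?S \<longleftrightarrow> _")
proof
  assume sub: "?C \<subseteq> ?S"
  show "s = t"
  proof (rule ccontr)
    assume "s \<noteq> t"
    let ?D = "dir1 s * dir2 t - dir2 s * dir1 t"
    have D: "?D \<noteq> 0" using \<open>s \<noteq> t\<close> by (simp add: dir_det_eq_0_iff)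
    have "vec 0 0 ?D \<in> ?C"
      using bracket_in_commutator[OF vec_in_own_line vec_in_own_line]
      by (simp add: bracket_vec)
    with sub obtain u v where "vec 0 0 ?D
        = vec (u * dir1 s) (u * dir2 s) (u * c) + vec (v * dir1 t) (v * dir2 t) (v * e)"
      by (auto simp: space_sum_def line_def)
    then have uv: "u * dir1 s + v * dir1 t = 0" "u * dir2 s + v * dir2 t = 0" "?D = u * c + v * e"
      by (simp_all add: vec_add vec_eq_iff)
    \<comment> \<open>Eliminating \<open>v\<close> or \<open>u\<close> from the first two equations:
      the right-hand sides vanish, and \<open>?D\<close> is nonzero.\<close>
    have "u * ?D = (u * dir1 s + v * dir1 t) * dir2 t - (u * dir2 s + v * dir2 t) * dir1 t"
      "v * ?D = (u * dir2 s + v * dir2 t) * dir1 s - (u * dir1 s + v * dir1 t) * dir2 s"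
      by (simp_all add: algebra_simps)
    then have "u = 0" "v = 0" using uv D by auto
    then show False using uv D by simp
  qed
next
  assume "s = t"
  then have "?C \<subseteq> {0}"
    by (intro commutator_trivial) (auto simp: line_def bracket_vec vec_0)
  moreover have "0 \<in> ?S"
    using space_sum_left lie_subalgebra_0 lie_subalgebra_line by blast
  ultimately show "?C \<subseteq> ?S" by blast
qed

lemma commutator_subset_space_sum_iff:
  assumes A: "lie_subalgebra A" and B: "lie_subalgebra B"
  shows "\<not> commutator A B \<subseteq> space_sum A B \<longleftrightarrow>
    (\<exists>s c t e. s \<noteq> t \<and> A = line (s, c) \<and> B = line (t, e))" (is "?L \<longleftrightarrow> ?R")
proof
  assume L: ?L
  \<comment> \<open>If \<open>A\<close> or \<open>B\<close> contained \<open>z\<close>, it would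
    contain \<open>center_line\<close>, and then the sum would contain the commutator.\<close>
  have "z \<notin> A" "z \<notin> B"
    using L commutator_subset_center_line[of A B] center_line_subset[OF A] center_line_subset[OF B]
      space_sum_left[OF lie_subalgebra_0[OF B], of A]
      space_sum_right[OF lie_subalgebra_0[OF A], of B] by auto
  then have AB: "A = {0} \<or> A \<in> range line" "B = {0} \<or> B \<in> range line"
    using lie_subalgebra_without_z A B by auto
  have 0: "0 \<in> space_sum A B"
    using space_sum_left lie_subalgebra_0[OF A] lie_subalgebra_0[OF B] by blast
  \<comment> \<open>If \<open>A\<close> or \<open>B\<close> is zero, all brackets vanish and the
    commutator is zero, so it lies in the sum.\<close>
  have "bracket 0 v = 0" "bracket v 0 = 0" for v
    using bracket_scale_left[of 0 0 v] bracket_scale_right[of v 0 0] by simp_all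
  then have "A \<noteq> {0}" "B \<noteq> {0}"
    using commutator_trivial[of A B] L 0 by auto
  with AB obtain s c t e where "A = line (s, c)" "B = line (t, e)" by auto
  then show ?R using L commutator_line_line by auto
next
  assume ?R
  then show ?L using commutator_line_line by auto
qed

section \<open>Counting the pairs\<close>

text \<open>Counts the complement: the numerator is
  \<open>(q^2 + 2*q + 4)^2 - (q + 1) * q^3\<close>. The argument works over every finite
  field.\<close>

lemma sd_eq:
  assumes "finite (UNIV :: 'k set)"
  defines "q \<equiv> CARD('k)"
  shows "sd = (3 * real q ^ 3 + 12 * real q ^ 2 + 16 * real q + 16) / (real q ^ 2 + 2 * real q + 4) ^ 2"
proof -
  define good where "good = {(A, B). A \<in> subalgebras \<and> B \<in> subalgebras \<and>
    commutator A B \<subseteq> space_sum A B}"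
  \<comment> \<open>Parameters of the failing pairs: a first line, a point different from its own,
    and a free last coordinate for the second line.\<close>
  define I where "I = (SIGMA sc : (UNIV :: ('k option \<times> 'k) set). (- {fst sc}) \<times> (UNIV :: 'k set))"
  define bad where "bad = map_prod line line ` I"
  have fin: "finite (UNIV :: 'k option set)" "finite (UNIV :: ('k option \<times> 'k) set)"
    using assms by (simp_all add: finite_prod)
  have cs: "card subalgebras = q\<^sup>2 + 2 * q + 4"
    unfolding q_def by (rule card_subalgebras[OF assms(1)])
  then have fs: "finite subalgebras" by (simp add: card_ge_0_finite)
  have bad_sub: "bad \<subseteq> subalgebras \<times> subalgebras"
    by (auto simp: bad_def subalgebras_def lie_subalgebra_line)
  have "good = subalgebras \<times> subalgebras - bad"
  proof -
    have "(A, B) \<in> bad \<longleftrightarrow> (\<exists>s c t e. s \<noteq> t \<and> A = line (s, c) \<and> B = line (t, e))" for A B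
    proof
      assume "(A, B) \<in> bad"
      then show "\<exists>s c t e. s \<noteq> t \<and> A = line (s, c) \<and> B = line (t, e)"
        unfolding bad_def I_def by clarsimp metis
    next
      assume "\<exists>s c t e. s \<noteq> t \<and> A = line (s, c) \<and> B = line (t, e)"
      then obtain s c t e where AB: "s \<noteq> t" "A = line (s, c)" "B = line (t, e)" by blast
      then have "((s, c), (t, e)) \<in> I" by (simp add: I_def)
      then show "(A, B) \<in> bad"
        unfolding bad_def by (rule rev_image_eqI) (simp add: AB)
    qed
    then have "(A, B) \<in> bad \<longleftrightarrow> \<not> commutator A B \<subseteq> space_sum A B"
      if "A \<in> subalgebras" "B \<in> subalgebras" for A B
      using commutator_subset_space_sum_iff[of A B] that by (simp add: subalgebras_def)
    then show ?thesis unfolding good_def by blast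
  qed
  then have "card good = card subalgebras * card subalgebras - card bad"
    using bad_sub fs by (simp add: card_Diff_subset finite_subset[OF bad_sub] card_cartesian_product)
  \<comment> \<open>Ensures that the subtraction of natural numbers does not truncate and carries
    over to the reals.\<close>
  moreover have "card bad \<le> card subalgebras * card subalgebras"
    using card_mono[OF _ bad_sub] fs by (simp add: card_cartesian_product)
  ultimately have "real (card good) = real (card subalgebras) ^ 2 - real (card bad)"
    by (simp add: of_nat_diff power2_eq_square)
  \<comment> \<open>There are \<open>(q + 1) * q\<close> first lines; for each, \<open>q\<close>
    other points and \<open>q\<close> last coordinates remain.\<close>
  moreover have "card bad = (q + 1) * q * (q * q)"
  proof -
    have "inj_on (map_prod line line) I"
      using prod.inj_map[OF inj_line inj_line] by (rule inj_on_subset) simp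
    then have "card bad = card I" unfolding bad_def by (rule card_image)
    also have "\<dots> = (\<Sum>sc\<in>(UNIV :: ('k option \<times> 'k) set). card ((- {fst sc}) \<times> (UNIV :: 'k set)))"
      unfolding I_def using fin assms(1)
      by (intro card_SigmaI) (auto intro: finite_subset[OF subset_UNIV] simp: finite_prod)
    also have "\<dots> = (\<Sum>sc\<in>(UNIV :: ('k option \<times> 'k) set). q * q)"
      using fin assms(1)
      by (simp add: card_cartesian_product Compl_eq_Diff_UNIV card_Diff_subset card_UNIV_option q_def)
    finally show ?thesis
      using assms(1) by (simp add: card_prod card_UNIV_option q_def)
  qed
  ultimately have "real (card good) = 3 * real q ^ 3 + 12 * real q ^ 2 + 16 * real q + 16"
    by (simp add: cs power2_eq_square power3_eq_cube algebra_simps)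
  then show ?thesis
    unfolding sd_def good_def[symmetric] by (simp add: cs)
qed

end

theorem theorem1p2:
  fixes p :: nat
    and scale :: "'k::field \<Rightarrow> 'v::ab_group_add \<Rightarrow> 'v"
    and bracket :: "'v \<Rightarrow> 'v \<Rightarrow> 'v"
    and x y z :: 'v
  assumes "prime p"
    and "CARD('k) = p"
    and "heisenberg scale bracket x y z"
  shows "lie_algebra.sd scale bracket =
    (3 * real p ^ 3 + 12 * real p ^ 2 + 16 * real p + 16) / (real p ^ 2 + 2 * real p + 4) ^ 2"
proof -
  \<comment> \<open>\<open>CARD\<close> of an infinite type is 0, so a positive value gives
    finiteness.\<close>
  have "CARD('k) > 0"
    unfolding assms(2) using assms(1) by (rule prime_gt_0_nat)
  then have "finite (UNIV :: 'k set)" by (rule card_ge_0_finite)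
  from heisenberg.sd_eq[OF assms(3) this] show ?thesis
    unfolding assms(2) .
qed

end
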